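(* Let $0\le K\le N$, let $\mathcal{A}\subseteq\mathbb{F}_2^N$ be the set of error patterns available to the decoder, let $1\le T\le|\mathcal{A}|$ be the maximum number of tests, and fix a permutation law $\pi_{\underline{y}}$. Consider all ORB-type GRAND algorithms obtained by choosing $T$ distinct error patterns from $\mathcal{A}$ and an order $\underline{e}(1),\dots,\underline{e}(T)$ in which to test them, applied to the random code ensemble. Write $\underline{e}(T+1),\dots,\underline{e}(|\mathcal{A}|)$ for the untested elements of $\mathcal{A}$ (in any order) and $p_t$ for the average guessing posterior of $\underline{e}(t)$, $1\le t\le|\mathcal{A}|$. Then the ensemble-average decoding success probability $P_{\mathrm{succ}}$ is maximized (over all such choices and orderings) by any choice and ordering satisfying $$p_1\ge p_2\ge\cdots\ge p_T\quad\text{and}\quad p_i\ge p_j\ \ \text{for all } i\le T<j,$$ and any such choice and ordering also minimizes the average number of tests.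
   Context: Channel: $q_0,q_1$ are probability densities on $\mathbb{R}$; when $\underline{w}\in\mathbb{F}_2^N$ is sent, the output $\underline{Y}\in\mathbb{R}^N$ has density $\prod_i q_{w_i}(y_i)$. The log-likelihood ratios are $\ell_i=\log(q_0(y_i)/q_1(y_i))$ and the hard decision is $\theta(\underline{y})\in\mathbb{F}_2^N$ with $\theta(\underline y)_i=\mathbf{1}(\ell_i<0)$. ORB-type GRAND: an ordered list of $T$ distinct vectors $\underline{e}(1),\dots,\underline{e}(T)\in\mathbb{F}_2^N$ (error patterns) is fixed in advance, independent of $\underline{Y}$; a permutation law assigns (measurably) to each $\underline{y}\in\mathbb{R}^N$ a permutation $\pi_{\underline{y}}$ of the coordinates $\{1,\dots,N\}$, acting on vectors of $\mathbb{F}_2^N$ by permuting coordinates. Given $\underline{y}$ and a codebook $\mathcal{C}$, the decoder tests for $t=1,2,\dots,T$ whether $\theta(\underline{y})\oplus\pi_{\underline{y}}(\underline{e}(t))\in\mathcal{C}$; it stops at the first $t$ for which this holds and outputs that codeword; if no $t\le T$ works, it stops after $T$ tests and declares failure. The number of tests is the value of $t$ at which it stops. Decoding succeeds if the output equals the transmitted codeword. Random code ensemble: the codewords $\underline{W}(1),\dots,\underline{W}(2^K)$ are drawn sequentially, uniformly without replacement, from $\mathbb{F}_2^N$; the transmitted message index is uniform on $\{1,\dots,2^K\}$ and independent of the codebook, and given the codebook and index the output $\underline{Y}$ depends only on the transmitted codeword. $P_{\mathrm{succ}}$ and the average number of tests are averaged over codebook, message and channel. Average guessing posterior (AGP) of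 an error pattern $\underline{e}$: $\mathbf{E}_{\underline{Y}}[P_{\underline{W}|\underline{Y}}(\theta(\underline{Y})\oplus\pi_{\underline{Y}}(\underline{e})\mid\underline{Y})]$, where $\underline{W}$ is the transmitted codeword (uniform on $\mathbb{F}_2^N$ after averaging over the ensemble) and $P_{\underline{W}|\underline{Y}}$ is the ensemble-averaged posterior. *)

theory Defs
  imports "HOL-Probability.Probability" "HOL-Library.Z2"
begin

instance bit :: finite
proof
  have "(UNIV :: bit set) = {0, 1}"
    by (auto intro: bit.exhaust)
  then show "finite (UNIV :: bit set)"
    by (metis finite.emptyI finite.insertI)
qed

text \<open>
  The blocklength \<open>N\<close> is \<open>CARD('n)\<close>; binary words are elements of \<open>bit ^ 'n\<close> (so that \<open>+\<close> is
  componentwise XOR) and channel outputs are elements of \<open>real ^ 'n\<close>.  A channel \<open>q\<close> maps each input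
  bit \<open>b\<close> to the output density \<open>q b\<close>.
\<close>

definition prob_density :: "(real \<Rightarrow> real) \<Rightarrow> bool" where
  "prob_density f \<longleftrightarrow>
     f \<in> borel_measurable borel \<and> (\<forall>x. 0 \<le> f x) \<and> has_bochner_integral lborel f 1"

definition channel_density ::
    "(bit \<Rightarrow> real \<Rightarrow> real) \<Rightarrow> bit ^ 'n::finite \<Rightarrow> real ^ 'n \<Rightarrow> real" where
  "channel_density q w y = (\<Prod>i\<in>UNIV. q (w $ i) (y $ i))"

text \<open>
  The log-likelihood ratio is extended-real valued, since \<open>ln (q 0 x / q 1 x)\<close> would give the wrong
  value \<open>0\<close> when exactly one density vanishes at \<open>x\<close>.  Where both vanish (an event of probability
  zero) it is set to \<open>0\<close>.
\<close>

definition llr :: "(bit \<Rightarrow> real \<Rightarrow> real) \<Rightarrow> real \<Rightarrow> ereal" where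
  "llr q x =
     (if q 0 x = 0 \<and> q 1 x = 0 then 0
      else if q 1 x = 0 then \<infinity>
      else if q 0 x = 0 then - \<infinity>
      else ereal (ln (q 0 x / q 1 x)))"

definition hard_decision :: "(bit \<Rightarrow> real \<Rightarrow> real) \<Rightarrow> real ^ 'n::finite \<Rightarrow> bit ^ 'n" where
  "hard_decision q y = (\<chi> i. if llr q (y $ i) < 0 then 1 else 0)"

text \<open>Left action: the entry at coordinate \<open>i\<close> is moved to coordinate \<open>\<sigma> i\<close>.\<close>

definition permute_word :: "('n::finite \<Rightarrow> 'n) \<Rightarrow> bit ^ 'n \<Rightarrow> bit ^ 'n" where
  "permute_word \<sigma> e = (\<chi> i. e $ (inv \<sigma> i))"

definition permutation_law :: "(real ^ 'n::finite \<Rightarrow> 'n \<Rightarrow> 'n) \<Rightarrow> bool" where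
  "permutation_law \<pi> \<longleftrightarrow>
     (\<forall>y. \<pi> y permutes UNIV) \<and> \<pi> \<in> measurable borel (count_space UNIV)"

definition guess ::
    "(bit \<Rightarrow> real \<Rightarrow> real) \<Rightarrow> (real ^ 'n::finite \<Rightarrow> 'n \<Rightarrow> 'n) \<Rightarrow> real ^ 'n \<Rightarrow> bit ^ 'n \<Rightarrow> bit ^ 'n" where
  "guess q \<pi> y e = hard_decision q y + permute_word (\<pi> y) e"

text \<open>
  Query a list of candidates in order against a codebook \<open>C\<close>; returns the output (\<open>None\<close> is a
  declared failure) and the number of tests performed.
\<close>

primrec query :: "'a set \<Rightarrow> 'a list \<Rightarrow> 'a option \<times> nat" where
  "query C [] = (None, 0)"
| "query C (v # vs) = (if v \<in> C then (Some v, 1) else apsnd Suc (query C vs))"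

definition orb_grand ::
    "(bit \<Rightarrow> real \<Rightarrow> real) \<Rightarrow> (real ^ 'n::finite \<Rightarrow> 'n \<Rightarrow> 'n) \<Rightarrow> (bit ^ 'n) list \<Rightarrow>
     (bit ^ 'n) set \<Rightarrow> real ^ 'n \<Rightarrow> (bit ^ 'n) option \<times> nat" where
  "orb_grand q \<pi> es C y = query C (map (guess q \<pi> y) es)"

definition orb_choices :: "'a set \<Rightarrow> nat \<Rightarrow> 'a list set" where
  "orb_choices A T = {es. length es = T \<and> distinct es \<and> set es \<subseteq> A}"

text \<open>
  Sequential uniform drawing without replacement; meaningful as long as the number of draws does
  not exceed the size of the (finite) type.
\<close>

primrec draw_without_replacement :: "nat \<Rightarrow> 'a::finite list pmf" where
  "draw_without_replacement 0 = return_pmf []"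
| "draw_without_replacement (Suc m) =
     bind_pmf (draw_without_replacement m) (\<lambda>c.
       map_pmf (\<lambda>w. c @ [w]) (pmf_of_set (UNIV - set c)))"

definition codebook_message :: "nat \<Rightarrow> ((bit ^ 'n::finite) list \<times> nat) pmf" where
  "codebook_message K = pair_pmf (draw_without_replacement (2 ^ K)) (pmf_of_set {..<2 ^ K})"

text \<open>
  Joint law of codebook, message index and channel output: given codebook \<open>c\<close> and index \<open>m\<close>, the
  output has density \<open>channel_density q (c ! m)\<close>.
\<close>

definition ensemble ::
    "(bit \<Rightarrow> real \<Rightarrow> real) \<Rightarrow> nat \<Rightarrow> (((bit ^ 'n::finite) list \<times> nat) \<times> (real ^ 'n)) measure" where
  "ensemble q K =
     density (measure_pmf (codebook_message K) \<Otimes>\<^sub>M lborel)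
       (\<lambda>((c, m), y). ennreal (channel_density q (c ! m) y))"

definition success_prob ::
    "(bit \<Rightarrow> real \<Rightarrow> real) \<Rightarrow> nat \<Rightarrow> (real ^ 'n::finite \<Rightarrow> 'n \<Rightarrow> 'n) \<Rightarrow> (bit ^ 'n) list \<Rightarrow> real" where
  "success_prob q K \<pi> es =
     measure (ensemble q K)
       {((c, m), y) \<in> space (ensemble q K). fst (orb_grand q \<pi> es (set c) y) = Some (c ! m)}"

definition mean_tests ::
    "(bit \<Rightarrow> real \<Rightarrow> real) \<Rightarrow> nat \<Rightarrow> (real ^ 'n::finite \<Rightarrow> 'n \<Rightarrow> 'n) \<Rightarrow> (bit ^ 'n) list \<Rightarrow> real" where
  "mean_tests q K \<pi> es =
     (\<integral>((c, m), y). real (snd (orb_grand q \<pi> es (set c) y)) \<partial>ensemble q K)"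

definition transmitted_word :: "nat \<Rightarrow> (bit ^ 'n::finite) pmf" where
  "transmitted_word K = map_pmf (\<lambda>(c, m). c ! m) (codebook_message K)"

text \<open>Posterior of the transmitted codeword given the output, by Bayes' rule.\<close>

definition posterior ::
    "(bit \<Rightarrow> real \<Rightarrow> real) \<Rightarrow> nat \<Rightarrow> bit ^ 'n::finite \<Rightarrow> real ^ 'n \<Rightarrow> real" where
  "posterior q K w y =
     pmf (transmitted_word K) w * channel_density q w y /
     (\<Sum>w'\<in>UNIV. pmf (transmitted_word K) w' * channel_density q w' y)"

definition agp ::
    "(bit \<Rightarrow> real \<Rightarrow> real) \<Rightarrow> nat \<Rightarrow> (real ^ 'n::finite \<Rightarrow> 'n \<Rightarrow> 'n) \<Rightarrow> bit ^ 'n \<Rightarrow> real" where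
  "agp q K \<pi> e = (\<integral>(_, y). posterior q K (guess q \<pi> y e) y \<partial>ensemble q K)"

end

theory Submission
  imports Defs
begin

text \<open>
  Drawing without replacement is invariant under bijections of the alphabet, so the probability that
  the transmitted word is \<open>w\<close> and the codebook avoids a set \<open>S\<close> not containing \<open>w\<close> is a function
  \<open>a\<close> of \<open>card S\<close> alone, and \<open>a\<close> is nonincreasing.  Let \<open>P e\<close> be the integral over \<open>y\<close> of the
  channel density of the guess for \<open>e\<close>; the average guessing posterior is \<open>a 0 * P e\<close>.  The guesses
  for one \<open>y\<close> are distinct, so the success probability of \<open>e\<^sub>0, \<dots>, e\<^bsub>T-1\<^esub>\<close> is \<open>\<Sum>t<T. a t * P e\<^sub>t\<close>.
  The number of tests exceeds \<open>t < T\<close> iff the first \<open>t\<close> guesses miss the codebook, so its mean is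
  \<open>\<Sum>t<T. a t * (2^N - (\<Sum>s<t. P e\<^sub>s))\<close>.  Both are monotone in the prefix sums of \<open>P\<close> (the
  first by Abel summation), and the ordering by decreasing posterior maximizes every prefix sum.
\<close>

section \<open>Inequalities for sums with dominated prefixes\<close>

text \<open>The part common to \<open>B\<close> and \<open>E\<close> cancels. What remains on either
  side has the same size, so any bijection between the two differences compares the sums term by
  term.\<close>

lemma sum_le_sum_dominating:
  fixes f :: "'a \<Rightarrow> real"
  assumes "finite B" "finite E" "card B = card E"
    and dom: "\<And>x y. x \<in> E \<Longrightarrow> y \<in> B - E \<Longrightarrow> f y \<le> f x"
  shows "sum f B \<le> sum f E"
proof -
  have "card (B - E) = card (E - B)"
    using assms by (simp add: card_Diff_subset_Int Int_commute)
  then obtain g where g: "bij_betw g (B - E) (E - B)"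
    using assms finite_same_card_bij[of "B - E" "E - B"] by auto
  have "sum f (B - E) \<le> (\<Sum>y\<in>B - E. f (g y))"
    using g by (intro sum_mono dom) (auto dest: bij_betwE)
  also have "\<dots> = sum f (E - B)"
    by (rule sum.reindex_bij_betw[OF g])
  finally have "sum f (B - E) \<le> sum f (E - B)" .
  moreover have "sum f B = sum f (B \<inter> E) + sum f (B - E)"
    using assms by (simp add: sum.Int_Diff)
  moreover have "sum f E = sum f (B \<inter> E) + sum f (E - B)"
    using assms by (simp add: sum.Int_Diff[of E f B] Int_commute)
  ultimately show ?thesis by simp
qed

text \<open>Abel summation as an induction: passing to the smaller weight \<open>a (Suc n)\<close>
  can only lower the contribution of the earlier terms, because their sum is nonnegative.\<close>

lemma antimono_weighted_sum_ge:
  fixes a d :: "nat \<Rightarrow> real"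
  assumes "\<And>t. Suc t \<le> n \<Longrightarrow> a (Suc t) \<le> a t"
    and "\<And>k. k \<le> n \<Longrightarrow> 0 \<le> sum d {..<k}"
  shows "a n * sum d {..n} \<le> (\<Sum>t\<le>n. a t * d t)"
  using assms
proof (induction n)
  case (Suc n)
  have "a (Suc n) * sum d {..n} \<le> a n * sum d {..n}"
    using Suc.prems(1)[of n] Suc.prems(2)[of "Suc n"]
    by (intro mult_right_mono) (auto simp: lessThan_Suc_atMost)
  also have "\<dots> \<le> (\<Sum>t\<le>n. a t * d t)"
    using Suc by simp
  finally show ?case
    by (simp add: distrib_left)
qed simp

text \<open>Applies the previous inequality to the differences \<open>y t - x t\<close>; the last
  weight and the last prefix difference are nonnegative. Monotonicity is asked for below
  \<open>n\<close> because the weights supplied later decrease on an initial segment.\<close>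

lemma antimono_weighted_sum_mono:
  fixes a x y :: "nat \<Rightarrow> real"
  assumes a: "\<And>t. Suc t < n \<Longrightarrow> a (Suc t) \<le> a t" and nn: "\<And>t. t < n \<Longrightarrow> 0 \<le> a t"
    and prefix: "\<And>k. k \<le> n \<Longrightarrow> sum x {..<k} \<le> sum y {..<k}"
  shows "(\<Sum>t<n. a t * x t) \<le> (\<Sum>t<n. a t * y t)"
proof (cases n)
  case (Suc m)
  have "0 \<le> a m * (\<Sum>t\<le>m. y t - x t)"
    using nn[of m] prefix[of n] Suc by (simp add: sum_subtractf lessThan_Suc_atMost)
  also have "\<dots> \<le> (\<Sum>t\<le>m. a t * (y t - x t))"
    using a prefix Suc by (intro antimono_weighted_sum_ge) (auto simp: sum_subtractf)
  finally show ?thesis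
    by (simp add: Suc lessThan_Suc_atMost right_diff_distrib sum_subtractf)
qed simp

section \<open>Symmetry of the random codebook\<close>

text \<open>Three bijections are glued: \<open>S\<close> to \<open>S'\<close>, the point
  \<open>w\<close> to \<open>w'\<close>, and the remaining elements to each other, which are equally
  many by finiteness of the type.\<close>

lemma ex_bij_mapping_pointed_set:
  fixes S S' :: "'a::finite set"
  assumes "card S = card S'" "w \<notin> S" "w' \<notin> S'"
  obtains f where "bij f" "f ` S = S'" "f w = w'"
proof -
  obtain g where g: "bij_betw g S S'"
    using assms finite_same_card_bij[of S S'] by auto
  have "card (UNIV - insert w S) = card (UNIV - insert w' S')"
    using assms by (simp add: card_Diff_subset)
  then obtain h where h: "bij_betw h (UNIV - insert w S) (UNIV - insert w' S')"
    using finite_same_card_bij[of "UNIV - insert w S" "UNIV - insert w' S'"] by auto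
  define k where "k = h(w := w')"
  have "bij_betw k (UNIV - insert w S) (UNIV - insert w' S')"
    using h by (subst bij_betw_cong[of _ k h]) (auto simp: k_def)
  then have "bij_betw k (UNIV - insert w S \<union> {w}) (UNIV - insert w' S' \<union> {k w})"
    by (intro notIn_Un_bij_betw) (auto simp: k_def)
  moreover have "UNIV - insert w S \<union> {w} = - S" "UNIV - insert w' S' \<union> {k w} = - S'"
    using assms by (auto simp: k_def)
  ultimately have k: "bij_betw k (- S) (- S')" by simp
  define f where "f = (\<lambda>x. if x \<in> S then g x else k x)"
  have "bij_betw f (S \<union> - S) (S' \<union> - S')"
    unfolding f_def using g k by (intro bij_betw_disjoint_Un) auto
  moreover have "f ` S = S'"
    using g by (auto simp: f_def bij_betw_def)
  moreover have "f w = w'"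
    using assms by (auto simp: f_def k_def)
  ultimately show thesis
    using that[of f] by simp
qed

lemma length_draw_without_replacement:
  "c \<in> set_pmf (draw_without_replacement m) \<Longrightarrow> length c = m"
  by (induction m arbitrary: c) auto

text \<open>A bijection carries the uniform law on the words not yet drawn to the uniform law on the
  complement of the relabelled draws, so each draw preserves the symmetry.\<close>

lemma map_draw_without_replacement:
  fixes f :: "'a::finite \<Rightarrow> 'a"
  assumes f: "bij f" and "m \<le> CARD('a)"
  shows "map_pmf (map f) (draw_without_replacement m) = draw_without_replacement m"
  using assms(2)
proof (induction m)
  case (Suc m)
  let ?D = "draw_without_replacement m :: 'a list pmf"
  have step: "map_pmf f (pmf_of_set (UNIV - set c)) = pmf_of_set (UNIV - set (map f c))"
    if "c \<in> set_pmf ?D" for c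
  proof (intro map_pmf_of_set_bij_betw)
    show "bij_betw f (UNIV - set c) (UNIV - set (map f c))"
      using f by (auto simp: bij_betw_def image_set_diff intro: inj_on_subset)
    \<comment> \<open>Fewer words than the alphabet holds have been drawn, so
      \<open>pmf_of_set\<close> is applied to a nonempty set and really is uniform.\<close>
    have "card (set c) < CARD('a)"
      using card_length[of c] length_draw_without_replacement[OF that] Suc.prems by simp
    then show "UNIV - set c \<noteq> {}"
      by (metis Diff_eq_empty_iff top.extremum_unique less_irrefl)
  qed simp
  have "map_pmf (map f) (draw_without_replacement (Suc m)) =
      ?D \<bind> (\<lambda>c. map_pmf (\<lambda>w. map f c @ [w]) (map_pmf f (pmf_of_set (UNIV - set c))))"
    by (simp add: map_bind_pmf map_pmf_comp)
  also have "\<dots> = ?D \<bind> (\<lambda>c. map_pmf (\<lambda>w. map f c @ [w]) (pmf_of_set (UNIV - set (map f c))))"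
    by (intro bind_pmf_cong refl) (simp only: step)
  also have "\<dots> = map_pmf (map f) ?D \<bind> (\<lambda>c. map_pmf (\<lambda>w. c @ [w]) (pmf_of_set (UNIV - set c)))"
    by (simp add: bind_map_pmf)
  finally show ?case
    using Suc by simp
qed simp

lemma codebook_message_support:
  "(c, m) \<in> set_pmf (codebook_message K) \<Longrightarrow> length c = 2 ^ K \<and> m < 2 ^ K"
  by (auto simp: codebook_message_def lessThan_empty_iff
      dest: length_draw_without_replacement)

lemma finite_set_pmf_codebook_message:
  "finite (set_pmf (codebook_message K :: ((bit ^ 'n::finite) list \<times> nat) pmf))"
proof (rule finite_subset)
  show "set_pmf (codebook_message K :: ((bit ^ 'n) list \<times> nat) pmf)
      \<subseteq> {c. set c \<subseteq> UNIV \<and> length c = 2 ^ K} \<times> {..<2 ^ K}"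
    by (auto dest: codebook_message_support)
  show "finite ({c :: (bit ^ 'n) list. set c \<subseteq> UNIV \<and> length c = 2 ^ K} \<times> {..<2 ^ K :: nat})"
    by (intro finite_cartesian_product finite_lists_length_eq) auto
qed

text \<open>Here \<open>w\<close> plays the role of a guess and \<open>S\<close> that of the guesses
  tested before it. For empty \<open>S\<close> this is the prior of the transmitted word.\<close>

definition hit_avoid_prob :: "nat \<Rightarrow> bit ^ 'n::finite \<Rightarrow> (bit ^ 'n) set \<Rightarrow> real" where
  "hit_avoid_prob K w S =
     measure_pmf.prob (codebook_message K) {(c, m). c ! m = w \<and> set c \<inter> S = {}}"

lemma hit_avoid_prob_nonneg: "0 \<le> hit_avoid_prob K w S"
  by (simp add: hit_avoid_prob_def)

lemma hit_avoid_prob_antimono: "S \<subseteq> S' \<Longrightarrow> hit_avoid_prob K w S' \<le> hit_avoid_prob K w S"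
  unfolding hit_avoid_prob_def by (intro measure_pmf.finite_measure_mono) auto

text \<open>The transmitted word always belongs to the codebook, so the codebook cannot avoid a set
  containing it.\<close>

lemma hit_avoid_prob_mem:
  assumes "w \<in> S"
  shows "hit_avoid_prob K w S = 0"
proof -
  have "c ! m \<in> set c" if "(c, m) \<in> set_pmf (codebook_message K :: ((bit ^ 'n) list \<times> nat) pmf)"
    for c :: "(bit ^ 'n) list" and m
    using codebook_message_support[OF that] by simp
  then show ?thesis
    unfolding hit_avoid_prob_def measure_pmf_zero_iff using assms by fastforce
qed

lemma card_words: "CARD(bit ^ 'n::finite) = 2 ^ CARD('n)"
proof -
  have "(UNIV :: bit set) = {0, 1}"
    by (auto intro: bit.exhaust)
  then have "CARD(bit) = 2"
    by (metis card_2_iff zero_neq_one)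
  then show ?thesis
    by simp
qed

text \<open>Relabelling all words by a bijection that takes \<open>S\<close> to \<open>S'\<close>
  and \<open>w\<close> to \<open>w'\<close> leaves the law of codebook and index unchanged and turns
  one event into the other. The bound on \<open>K\<close> makes all \<open>2 ^ K\<close> draws
  possible.\<close>

lemma hit_avoid_prob_cong:
  fixes w w' :: "bit ^ 'n::finite"
  assumes "K \<le> CARD('n)" "card S = card S'" "w \<notin> S" "w' \<notin> S'"
  shows "hit_avoid_prob K w S = hit_avoid_prob K w' S'"
proof -
  obtain f where f: "bij f" "f ` S = S'" "f w = w'"
    using ex_bij_mapping_pointed_set assms(2-4) .
  let ?p = "codebook_message K :: ((bit ^ 'n) list \<times> nat) pmf"
  have "2 ^ K \<le> CARD(bit ^ 'n)"
    using assms(1) by (simp only: card_words) simp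
  then have "map_pmf (\<lambda>(c, m). (map f c, m)) ?p = ?p"
    by (simp add: codebook_message_def map_pair[where g="\<lambda>x. x", simplified]
        map_draw_without_replacement[OF f(1)])
  then have "hit_avoid_prob K w' S' = measure_pmf.prob (map_pmf (\<lambda>(c, m). (map f c, m)) ?p)
      {(c, m). c ! m = w' \<and> set c \<inter> S' = {}}"
    by (simp add: hit_avoid_prob_def)
  also have "\<dots> = measure_pmf.prob ?p
      {(c, m). map f c ! m = w' \<and> set (map f c) \<inter> S' = {}}"
    by (simp add: vimage_def case_prod_unfold)
  also have "\<dots> = hit_avoid_prob K w S"
    unfolding hit_avoid_prob_def
  proof (intro measure_pmf.finite_measure_eq_AE AE_pmfI)
    fix x assume "x \<in> set_pmf ?p"
    moreover obtain c m where "x = (c, m)" by force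
    ultimately have x: "x = (c, m)" "m < length c"
      using codebook_message_support[of c m] by auto
    have "map f c ! m = w' \<longleftrightarrow> c ! m = w"
      using x f by (auto simp: bij_def inj_eq)
    moreover have "set (map f c) \<inter> S' = f ` (set c \<inter> S)"
      using f by (simp add: bij_def image_Int)
    ultimately show "x \<in> {(c, m). map f c ! m = w' \<and> set (map f c) \<inter> S' = {}} \<longleftrightarrow>
        x \<in> {(c, m). c ! m = w \<and> set c \<inter> S = {}}"
      using x by simp
  qed simp_all
  finally show ?thesis ..
qed

lemma hit_avoid_prob_profile:
  assumes "K \<le> CARD('n::finite)"
  obtains a :: "nat \<Rightarrow> real"
    where "\<And>w S. w \<notin> S \<Longrightarrow> hit_avoid_prob K (w :: bit ^ 'n) S = a (card S)"
      and "\<And>k. 0 \<le> a k"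
      and "\<And>k. Suc k < CARD(bit ^ 'n) \<Longrightarrow> a (Suc k) \<le> a k"
proof -
  \<comment> \<open>The value \<open>a k\<close> is read off an arbitrary pair of size
    \<open>k\<close>. For \<open>k\<close> at least the number of words no such pair exists;
    \<open>a k\<close> is then an unspecified value of \<open>hit_avoid_prob\<close>, still
    nonnegative, and monotonicity is claimed only below that point.\<close>
  define P where "P k = (\<lambda>(w :: bit ^ 'n, S). w \<notin> S \<and> card S = k)" for k
  define a where "a k = (case SOME x. P k x of (w, S) \<Rightarrow> hit_avoid_prob K w S)" for k
  have eq: "hit_avoid_prob K w S = a (card S)" if "w \<notin> S" for w :: "bit ^ 'n" and S
  proof -
    have "P (card S) (SOME x. P (card S) x)"
      by (rule someI[of _ "(w, S)"]) (simp add: P_def that)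
    moreover obtain v R where x: "(SOME x. P (card S) x) = (v, R)"
      by fastforce
    ultimately have "v \<notin> R" "card R = card S"
      by (auto simp: P_def)
    then show ?thesis
      using hit_avoid_prob_cong[OF assms, of S R w v] that x by (simp add: a_def)
  qed
  moreover have "0 \<le> a k" for k
    by (simp add: a_def hit_avoid_prob_nonneg split: prod.split)
  moreover have "a (Suc k) \<le> a k" if k: "Suc k < CARD(bit ^ 'n)" for k
  proof -
    obtain S :: "(bit ^ 'n) set" where S: "card S = Suc k"
      using obtain_subset_with_card_n[OF less_imp_le[OF k]] by blast
    then obtain w where w: "w \<notin> S"
      using k by (metis UNIV_eq_I less_irrefl)
    obtain v where v: "v \<in> S"
      using S by fastforce
    have "a (Suc k) = hit_avoid_prob K w S"
      using eq[OF w] S by simp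
    also have "\<dots> \<le> hit_avoid_prob K w (S - {v})"
      by (intro hit_avoid_prob_antimono) auto
    also have "\<dots> = a k"
      using eq[of w "S - {v}"] w v S by simp
    finally show ?thesis .
  qed
  ultimately show thesis
    by (rule that)
qed

section \<open>The decoder's output and test count as sums of indicators\<close>

text \<open>At most one summand is nonzero: once \<open>w\<close> has been tested, every later
  prefix contains it and so meets \<open>C\<close>. The nonzero one marks the position where the
  search stops with output \<open>w\<close>.\<close>

lemma of_bool_query_success:
  assumes "w \<in> C"
  shows "of_bool (fst (query C vs) = Some w) =
    (\<Sum>t<length vs. of_bool (vs ! t = w \<and> C \<inter> set (take t vs) = {}) :: real)"
proof (induction vs)
  case (Cons v vs)
  have "(\<Sum>t<length (v # vs). of_bool ((v # vs) ! t = w \<and> C \<inter> set (take t (v # vs)) = {}) :: real)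
      = of_bool (v = w) + (\<Sum>t<length vs. of_bool (vs ! t = w \<and> C \<inter> insert v (set (take t vs)) = {}))"
    by (simp only: length_Cons sum.lessThan_Suc_shift) simp
  then show ?case
    using Cons assms by (cases "v \<in> C") (auto simp del: sum_of_bool_eq)
qed simp

text \<open>Tail-sum formula: with positions counted from 0, the test at \<open>t\<close> is carried
  out exactly when the \<open>t\<close> earlier candidates miss \<open>C\<close>. A failed search
  contributes every term.\<close>

lemma real_query_count:
  "real (snd (query C vs)) = (\<Sum>t<length vs. of_bool (C \<inter> set (take t vs) = {}))"
proof (induction vs)
  case (Cons v vs)
  have "(\<Sum>t<length (v # vs). of_bool (C \<inter> set (take t (v # vs)) = {}) :: real)
      = 1 + (\<Sum>t<length vs. of_bool (C \<inter> insert v (set (take t vs)) = {}))"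
    by (simp only: length_Cons sum.lessThan_Suc_shift) simp
  then show ?case
    using Cons by (cases "v \<in> C") (auto simp del: sum_of_bool_eq)
qed simp

section \<open>Channel densities and measurability of the guesses\<close>

text \<open>The product formula for \<open>lborel\<close> runs over \<open>Basis\<close>; for
  \<open>real ^ 'n\<close> the basis vectors are the \<open>axis i 1\<close>, so reindexing turns it
  into a product over coordinates.\<close>

lemma nn_integral_lborel_vec_prod:
  fixes f :: "'n::finite \<Rightarrow> real \<Rightarrow> real"
  assumes "\<And>i. f i \<in> borel_measurable borel" "\<And>i x. 0 \<le> f i x"
  shows "(\<integral>\<^sup>+y. ennreal (\<Prod>i\<in>UNIV. f i (y $ i)) \<partial>lborel) = (\<Prod>i\<in>UNIV. \<integral>\<^sup>+x. ennreal (f i x) \<partial>lborel)"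
proof -
  let ?ax = "\<lambda>i :: 'n. axis i (1 :: real)"
  have inj: "inj ?ax"
    by (auto simp: inj_on_def axis_eq_axis)
  have Basis: "(Basis :: (real ^ 'n) set) = range ?ax"
    by (auto simp: Basis_vec_def)
  define g where "g b x = ennreal (f (inv ?ax b) x)" for b x
  have g: "g (?ax i) = (\<lambda>x. ennreal (f i x))" for i
    by (simp add: g_def[abs_def] inv_f_f[OF inj])
  have "(\<integral>\<^sup>+y. ennreal (\<Prod>i\<in>UNIV. f i (y $ i)) \<partial>lborel) =
      (\<integral>\<^sup>+y. (\<Prod>b\<in>Basis. g b (y \<bullet> b)) \<partial>lborel)"
    unfolding Basis using assms
    by (simp add: prod.reindex[OF inj] g inner_axis prod_ennreal)
  also have "\<dots> = (\<Prod>b\<in>Basis. \<integral>\<^sup>+x. g b x \<partial>lborel)"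
    using assms by (intro nn_integral_lborel_prod) (auto simp: g_def)
  also have "\<dots> = (\<Prod>i\<in>UNIV. \<integral>\<^sup>+x. ennreal (f i x) \<partial>lborel)"
    unfolding Basis by (simp add: prod.reindex[OF inj] g)
  finally show ?thesis .
qed

text \<open>Allows joint measurability in codebook, index and output to be checked in the output
  alone, with codebook and index fixed.\<close>

lemma countable_codebook_message: "countable (UNIV :: ((bit ^ 'n::finite) list \<times> nat) set)"
proof -
  have "countable (UNIV :: (bit ^ 'n) list set)"
    using countable_lists[of "UNIV :: (bit ^ 'n) set"] by (simp add: lists_UNIV countable_finite)
  then show ?thesis
    by (simp flip: UNIV_Times_UNIV)
qed

lemma inj_permute_word:
  assumes "\<sigma> permutes UNIV"
  shows "inj (permute_word \<sigma>)"
proof (rule injI)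
  fix e e' :: "bit ^ 'a"
  assume "permute_word \<sigma> e = permute_word \<sigma> e'"
  then have "e $ inv \<sigma> (\<sigma> i) = e' $ inv \<sigma> (\<sigma> i)" for i
    unfolding permute_word_def vec_eq_iff by simp
  then show "e = e'"
    using permutes_inverses(2)[OF assms] by (simp add: vec_eq_iff)
qed

lemma transmitted_word_eq_hit_avoid_prob:
  "pmf (transmitted_word K) w = hit_avoid_prob K w {}"
  by (simp add: transmitted_word_def pmf_map hit_avoid_prob_def vimage_def case_prod_unfold)

locale orb_setup =
  fixes q :: "bit \<Rightarrow> real \<Rightarrow> real" and \<pi> :: "real ^ 'n::finite \<Rightarrow> 'n \<Rightarrow> 'n"
  assumes density: "prob_density (q b)"
    and law: "permutation_law \<pi>"
begin

lemma measurable_density [measurable]: "q b \<in> borel_measurable borel"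
  using density by (simp add: prob_density_def)

lemma density_nonneg: "0 \<le> q b x"
  using density by (simp add: prob_density_def)

lemma nn_integral_density: "(\<integral>\<^sup>+x. ennreal (q b x) \<partial>lborel) = 1"
  using density[of b]
  by (simp add: prob_density_def nn_integral_eq_integral has_bochner_integral_iff density_nonneg)

lemma channel_density_nonneg: "0 \<le> channel_density q w y"
  by (simp add: channel_density_def density_nonneg prod_nonneg)

lemma measurable_channel_density [measurable]: "channel_density q w \<in> borel_measurable borel"
  unfolding channel_density_def by measurable

lemma nn_integral_channel_density:
  "(\<integral>\<^sup>+y. ennreal (channel_density q (w :: bit ^ 'n) y) \<partial>lborel) = 1"
  unfolding channel_density_def
  by (subst nn_integral_lborel_vec_prod) (auto simp: density_nonneg nn_integral_density)

lemma integrable_channel_density: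
  "integrable lborel (channel_density q (w :: bit ^ 'n))"
  by (intro integrableI_nn_integral_finite[where x=1])
    (auto simp: channel_density_nonneg nn_integral_channel_density)

lemma integral_channel_density: "(\<integral>y. channel_density q (w :: bit ^ 'n) y \<partial>lborel) = 1"
  by (subst integral_eq_nn_integral)
    (auto simp: channel_density_nonneg nn_integral_channel_density)

lemma measurable_hard_decision: "hard_decision q \<in> measurable borel (count_space (UNIV :: (bit ^ 'n) set))"
proof -
  have [measurable]: "(\<lambda>y. llr q (y $ i)) \<in> borel_measurable borel" for i :: 'n
    unfolding llr_def by measurable
  have "{y. hard_decision q y = w} \<in> sets borel" for w :: "bit ^ 'n"
  proof -
    have "((if P then 1 else 0) = w $ i) = (P = (w $ i = 1))" for P i
      by (cases "w $ i") auto
    then have "{y. hard_decision q y = w} =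
        {y \<in> space borel. \<forall>i. (llr q (y $ i) < 0) = (w $ i = 1)}"
      unfolding hard_decision_def vec_eq_iff by simp
    also have "\<dots> \<in> sets borel"
      by measurable
    finally show ?thesis .
  qed
  then show ?thesis
    by (subst measurable_count_space_eq2) (auto simp: vimage_def)
qed

text \<open>Hard decision and permutation take finitely many values, so measurability may be checked
  with the guessing map frozen to one \<open>g\<close>. Taking the whole map as argument lets
  \<open>h\<close> depend on a list of guesses at once.\<close>

lemma measurable_guess:
  assumes "\<And>g. h g \<in> measurable borel N"
  shows "(\<lambda>y. h (guess q \<pi> y) y) \<in> measurable borel N"
proof -
  have "(\<lambda>y. h (\<lambda>e. hard_decision q y + permute_word \<sigma> e) y) \<in> measurable borel N" for \<sigma>
    using measurable_hard_decision
    by (rule measurable_compose_countable'[where f="\<lambda>w y. h (\<lambda>e. w + permute_word \<sigma> e) y", OF assms])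
      (simp add: countable_finite)
  moreover have "\<pi> \<in> measurable borel (count_space UNIV)"
    using law by (simp add: permutation_law_def)
  ultimately have "(\<lambda>y. h (\<lambda>e. hard_decision q y + permute_word (\<pi> y) e) y) \<in> measurable borel N"
    by (rule measurable_compose_countable'[where
          f="\<lambda>\<sigma> y. h (\<lambda>e. hard_decision q y + permute_word \<sigma> e) y"])
      (simp add: countable_finite)
  then show ?thesis
    by (simp add: guess_def[abs_def])
qed

lemma inj_guess: "inj (guess q \<pi> y)"
  using inj_permute_word[of "\<pi> y"] law
  by (auto simp: guess_def permutation_law_def inj_on_def)

text \<open>The guess varies with \<open>y\<close>, but its density is dominated by the sum of the
  densities of all words.\<close>

lemma integrable_guess_density:
  "integrable lborel (\<lambda>y. channel_density q (guess q \<pi> y e) y)"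
proof (rule Bochner_Integration.integrable_bound)
  show "integrable lborel (\<lambda>y. \<Sum>w\<in>UNIV. channel_density q (w :: bit ^ 'n) y)"
    by (intro Bochner_Integration.integrable_sum integrable_channel_density)
  show "(\<lambda>y. channel_density q (guess q \<pi> y e) y) \<in> borel_measurable lborel"
    using measurable_guess[of "\<lambda>g. channel_density q (g e)" borel] by simp
  show "AE y in lborel. norm (channel_density q (guess q \<pi> y e) y)
      \<le> norm (\<Sum>w\<in>UNIV. channel_density q (w :: bit ^ 'n) y)"
    by (intro AE_I2) (auto simp: channel_density_nonneg sum_nonneg intro!: member_le_sum)
qed

section \<open>Averaging over codebook, message and channel\<close>

text \<open>Fubini puts the output outermost, so that the inner expectation is over the codebook
  while the guesses stay fixed. Boundedness of \<open>G\<close> gives integrability, as the density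
  \<open>D\<close> has total mass 1.\<close>

lemma integral_ensemble:
  fixes G :: "(bit ^ 'n) list \<times> nat \<Rightarrow> real ^ 'n \<Rightarrow> real"
  assumes G: "\<And>x. G x \<in> borel_measurable borel" and bound: "\<And>x y. \<bar>G x y\<bar> \<le> B"
  shows "(\<integral>(x, y). G x y \<partial>ensemble q K) =
    (\<integral>y. (\<integral>x. G x y * channel_density q (fst x ! snd x) y \<partial>measure_pmf (codebook_message K)) \<partial>lborel)"
proof -
  let ?p = "codebook_message K :: ((bit ^ 'n) list \<times> nat) pmf"
  let ?M = "measure_pmf ?p \<Otimes>\<^sub>M (lborel :: (real ^ 'n) measure)"
  define D where "D x y = channel_density q (fst x ! snd x) y" for x :: "(bit ^ 'n) list \<times> nat" and y
  interpret pair_sigma_finite "measure_pmf ?p" "lborel :: (real ^ 'n) measure" ..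
  have meas: "case_prod F \<in> borel_measurable ?M"
    if "\<And>x. F x \<in> borel_measurable borel" for F :: "(bit ^ 'n) list \<times> nat \<Rightarrow> real ^ 'n \<Rightarrow> real"
  proof -
    have "case_prod F \<in> borel_measurable (count_space UNIV \<Otimes>\<^sub>M lborel)"
      using that by (intro measurable_pair_measure_countable1 countable_codebook_message) simp
    then show ?thesis
      by (simp cong: measurable_cong_sets sets_pair_measure_cong)
  qed
  have D [measurable]: "case_prod D \<in> borel_measurable ?M"
    by (intro meas) (simp add: D_def[abs_def])
  have G' [measurable]: "case_prod G \<in> borel_measurable ?M"
    by (intro meas G)
  have D_nonneg: "0 \<le> D x y" for x y
    by (simp add: D_def channel_density_nonneg)
  have "(\<integral>\<^sup>+z. ennreal (case_prod D z) \<partial>?M) = (\<integral>\<^sup>+x. \<integral>\<^sup>+y. ennreal (D x y) \<partial>lborel \<partial>measure_pmf ?p)"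
    by (subst lborel.nn_integral_fst[symmetric]) auto
  also have "\<dots> = 1"
    by (simp add: D_def nn_integral_channel_density)
  finally have "integrable ?M (case_prod D)"
    by (intro integrableI_nn_integral_finite[where x=1]) (auto simp: D_nonneg)
  then have "integrable ?M (\<lambda>z. B * case_prod D z)"
    by simp
  then have "integrable ?M (\<lambda>(x, y). G x y * D x y)"
  proof (rule Bochner_Integration.integrable_bound)
    show "(\<lambda>(x, y). G x y * D x y) \<in> borel_measurable ?M"
      by (intro meas) (simp add: D_def[abs_def] G)
    show "AE z in ?M. norm (case z of (x, y) \<Rightarrow> G x y * D x y) \<le> norm (B * case_prod D z)"
      using bound by (intro AE_I2)
        (auto simp: abs_mult D_nonneg intro!: mult_right_mono order.trans[OF bound abs_ge_self])
  qed
  then have "(\<integral>y. (\<integral>x. G x y * D x y \<partial>measure_pmf ?p) \<partial>lborel) = (\<integral>(x, y). G x y * D x y \<partial>?M)"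
    by (rule integral_snd)
  also have "\<dots> = (\<integral>z. case_prod D z *\<^sub>R case_prod G z \<partial>?M)"
    by (intro Bochner_Integration.integral_cong) auto
  also have "\<dots> = (\<integral>z. case_prod G z \<partial>density ?M (case_prod D))"
    by (intro integral_density[symmetric]) (auto simp: D_nonneg)
  also have "density ?M (case_prod D) = ensemble q K"
    unfolding ensemble_def D_def by (simp add: case_prod_unfold)
  finally show ?thesis
    by (simp add: D_def)
qed

text \<open>On the event in question the transmitted word is \<open>w\<close>, so the density factor
  is constant and leaves the expectation.\<close>

lemma expectation_hit_avoid:
  "(\<integral>x. of_bool (fst x ! snd x = w \<and> set (fst x) \<inter> S = {}) * channel_density q (fst x ! snd x) y
      \<partial>measure_pmf (codebook_message K)) = hit_avoid_prob K w S * channel_density q (w :: bit ^ 'n) y"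
proof -
  let ?A = "{(c, m). c ! m = w \<and> set c \<inter> S = {}}"
  have "(\<integral>x. of_bool (fst x ! snd x = w \<and> set (fst x) \<inter> S = {}) * channel_density q (fst x ! snd x) y
      \<partial>measure_pmf (codebook_message K)) =
    (\<integral>x. indicator ?A x * channel_density q w y \<partial>measure_pmf (codebook_message K))"
    by (intro Bochner_Integration.integral_cong) (auto simp: indicator_def)
  then show ?thesis
    by (simp add: hit_avoid_prob_def)
qed

text \<open>Splits the event according to the value of the transmitted word.\<close>

lemma expectation_avoid:
  "(\<integral>x. of_bool (set (fst x) \<inter> S = {}) * channel_density q (fst x ! snd x) y
      \<partial>measure_pmf (codebook_message K)) =
    (\<Sum>w\<in>UNIV. hit_avoid_prob K w S * channel_density q (w :: bit ^ 'n) y)"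
proof -
  have "of_bool (set (fst x) \<inter> S = {}) * channel_density q (fst x ! snd x) y =
      (\<Sum>w\<in>UNIV. of_bool (fst x ! snd x = w \<and> set (fst x) \<inter> S = {}) * channel_density q (fst x ! snd x) y)"
    for x :: "(bit ^ 'n) list \<times> nat"
    by (subst sum.remove[of _ "fst x ! snd x"]) (auto intro!: sum.neutral)
  then have "(\<integral>x. of_bool (set (fst x) \<inter> S = {}) * channel_density q (fst x ! snd x) y
      \<partial>measure_pmf (codebook_message K)) =
    (\<integral>x. (\<Sum>w\<in>UNIV. of_bool (fst x ! snd x = w \<and> set (fst x) \<inter> S = {}) * channel_density q (fst x ! snd x) y)
      \<partial>measure_pmf (codebook_message K))"
    by presburger
  also have "\<dots> = (\<Sum>w\<in>UNIV. \<integral>x. of_bool (fst x ! snd x = w \<and> set (fst x) \<inter> S = {}) * channel_density q (fst x ! snd x) y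
      \<partial>measure_pmf (codebook_message K))"
    by (intro Bochner_Integration.integral_sum integrable_measure_pmf_finite finite_set_pmf_codebook_message)
  finally show ?thesis
    by (simp only: expectation_hit_avoid)
qed

text \<open>Keeping the constant prior out of this quantity leaves the dependence on the codebook to
  the weights \<open>a t\<close>.\<close>

definition guess_mass :: "bit ^ 'n \<Rightarrow> real" where
  "guess_mass e = (\<integral>y. channel_density q (guess q \<pi> y e) y \<partial>lborel)"

text \<open>With a uniform prior the denominator of the posterior is, up to the factor
  \<open>b\<close>, the density of the output, and averaging over the output cancels it.\<close>

lemma agp_eq_guess_mass:
  assumes unif: "\<And>w :: bit ^ 'n. hit_avoid_prob K w {} = b" and "0 < b"
  shows "agp q K \<pi> e = b * guess_mass e"
proof -
  let ?D = "\<lambda>w y. channel_density q (w :: bit ^ 'n) y"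
  have posterior: "posterior q K w y = ?D w y / (\<Sum>w'\<in>UNIV. ?D w' y)" for w :: "bit ^ 'n" and y
    using \<open>0 < b\<close>
    by (simp add: posterior_def transmitted_word_eq_hit_avoid_prob unif flip: sum_distrib_left)
  have D_le: "?D w y \<le> (\<Sum>w'\<in>UNIV. ?D w' y)" for w y
    by (intro member_le_sum) (auto simp: channel_density_nonneg)
  have bound: "\<bar>posterior q K w y\<bar> \<le> 1" for w :: "bit ^ 'n" and y
    unfolding posterior using D_le[of w y] channel_density_nonneg[of w y]
    by (auto simp: divide_le_eq_1)
  have "agp q K \<pi> e = (\<integral>y. (\<integral>x. posterior q K (guess q \<pi> y e) y * ?D (fst x ! snd x) y
      \<partial>measure_pmf (codebook_message K)) \<partial>lborel)"
    unfolding agp_def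
  proof (rule integral_ensemble)
    show "(\<lambda>y. posterior q K (guess q \<pi> y e) y) \<in> borel_measurable borel"
      unfolding posterior by (rule measurable_guess[of "\<lambda>g y. ?D (g e) y / (\<Sum>w'\<in>UNIV. ?D w' y)"]) measurable
  qed (rule bound)
  also have "\<dots> = (\<integral>y. b * ?D (guess q \<pi> y e) y \<partial>lborel)"
  proof (intro Bochner_Integration.integral_cong refl)
    fix y
    have "(\<integral>x. posterior q K (guess q \<pi> y e) y * ?D (fst x ! snd x) y \<partial>measure_pmf (codebook_message K))
        = posterior q K (guess q \<pi> y e) y * (b * (\<Sum>w\<in>UNIV. ?D w y))"
      using expectation_avoid[where S="{}"] by (simp add: unif flip: sum_distrib_left)
    \<comment> \<open>Where the total density vanishes, so does the density of each word, and the
      convention for division by zero makes both sides 0.\<close>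
    also have "\<dots> = b * ?D (guess q \<pi> y e) y"
      using D_le[of "guess q \<pi> y e" y] channel_density_nonneg[of "guess q \<pi> y e" y]
      by (auto simp: posterior)
    finally show "(\<integral>x. posterior q K (guess q \<pi> y e) y * ?D (fst x ! snd x) y
        \<partial>measure_pmf (codebook_message K)) = b * ?D (guess q \<pi> y e) y" .
  qed
  finally show ?thesis
    by (simp add: guess_mass_def)
qed

section \<open>Closed forms for success probability and mean number of tests\<close>

lemma distinct_map_guess: "distinct es \<Longrightarrow> distinct (map (guess q \<pi> y) es)"
  using inj_guess[of y] by (auto simp: distinct_map inj_on_def)

text \<open>Since guessing is injective for each \<open>y\<close>, the set of earlier guesses has
  size \<open>t\<close> for every output. This makes the weight \<open>a t\<close> independent of
  \<open>y\<close>.\<close>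

lemma set_take_guess:
  assumes "distinct es" "t \<le> length es"
  shows "card (set (take t (map (guess q \<pi> y) es))) = t"
    and "(\<Sum>w\<in>set (take t (map (guess q \<pi> y) es)). f w) = (\<Sum>s<t. f (guess q \<pi> y (es ! s)))"
proof -
  have "distinct (take t (map (guess q \<pi> y) es))"
    by (intro distinct_take distinct_map_guess assms(1))
  then show "card (set (take t (map (guess q \<pi> y) es))) = t"
    using assms by (simp add: distinct_card)
  show "(\<Sum>w\<in>set (take t (map (guess q \<pi> y) es)). f w) = (\<Sum>s<t. f (guess q \<pi> y (es ! s)))"
    using assms \<open>distinct (take t (map (guess q \<pi> y) es))\<close>
    by (simp add: sum.distinct_set_conv_list sum_list_sum_nth atLeast0LessThan)
qed

lemma success_prob_eq_sum:
  assumes a: "\<And>w S. w \<notin> S \<Longrightarrow> hit_avoid_prob K (w :: bit ^ 'n) S = a (card S)"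
    and es: "distinct es"
  shows "success_prob q K \<pi> es = (\<Sum>t<length es. a t * guess_mass (es ! t))"
proof -
  let ?D = "\<lambda>w y. channel_density q (w :: bit ^ 'n) y"
  let ?V = "\<lambda>y. map (guess q \<pi> y) es"
  define G :: "(bit ^ 'n) list \<times> nat \<Rightarrow> real ^ 'n \<Rightarrow> real" where
    "G x y = of_bool (fst (query (set (fst x)) (?V y)) = Some (fst x ! snd x))" for x y
  let ?succ = "{((c, m), y) \<in> space (ensemble q K). fst (orb_grand q \<pi> es (set c) y) = Some (c ! m)}"
  have "?succ \<inter> space (ensemble q K) = ?succ"
    by auto
  then have "success_prob q K \<pi> es = (\<integral>z. indicator ?succ z \<partial>ensemble q K)"
    by (simp add: success_prob_def)
  also have "\<dots> = (\<integral>(x, y). G x y \<partial>ensemble q K)"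
    by (intro Bochner_Integration.integral_cong refl)
      (auto simp: G_def orb_grand_def indicator_def split: prod.split)
  also have "\<dots> = (\<integral>y. (\<integral>x. G x y * ?D (fst x ! snd x) y \<partial>measure_pmf (codebook_message K)) \<partial>lborel)"
  proof (rule integral_ensemble)
    show "G x \<in> borel_measurable borel" for x
      unfolding G_def
      by (rule measurable_guess[of "\<lambda>g y. of_bool (fst (query (set (fst x)) (map g es)) = Some (fst x ! snd x))"])
        measurable
    show "\<bar>G x y\<bar> \<le> 1" for x y
      by (simp add: G_def)
  qed
  also have "\<dots> = (\<integral>y. (\<Sum>t<length es. a t * ?D (guess q \<pi> y (es ! t)) y) \<partial>lborel)"
  proof (intro Bochner_Integration.integral_cong refl)
    fix y
    let ?E = "\<lambda>t x. of_bool (fst x ! snd x = ?V y ! t \<and> set (fst x) \<inter> set (take t (?V y)) = {}) * ?D (fst x ! snd x) y"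
    have "G x y = (\<Sum>t<length es. of_bool (fst x ! snd x = ?V y ! t \<and> set (fst x) \<inter> set (take t (?V y)) = {}))"
      \<comment> \<open>On the support the index is in range, so the transmitted word is a codeword,
        as the indicator expansion requires; off the support this may fail, hence the
        almost-everywhere argument below.\<close>
      if "x \<in> set_pmf (codebook_message K)" for x
    proof -
      have "fst x ! snd x \<in> set (fst x)"
        using codebook_message_support[of "fst x" "snd x" K] that by simp
      from of_bool_query_success[OF this, of "?V y"] show ?thesis
        unfolding G_def by (simp only: length_map eq_commute[of "?V y ! _"])
    qed
    then have "(\<integral>x. G x y * ?D (fst x ! snd x) y \<partial>measure_pmf (codebook_message K)) =
        (\<integral>x. (\<Sum>t<length es. ?E t x) \<partial>measure_pmf (codebook_message K))"
      by (intro integral_cong_AE AE_pmfI) (simp_all only: sum_distrib_right, simp_all)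
    also have "\<dots> = (\<Sum>t<length es. \<integral>x. ?E t x \<partial>measure_pmf (codebook_message K))"
      by (intro Bochner_Integration.integral_sum integrable_measure_pmf_finite finite_set_pmf_codebook_message)
    also have "\<dots> = (\<Sum>t<length es. a t * ?D (guess q \<pi> y (es ! t)) y)"
    proof (intro sum.cong refl)
      fix t assume t: "t \<in> {..<length es}"
      \<comment> \<open>Distinctness of one guess more than the prefix puts the guess at
        \<open>t\<close> outside the earlier ones, where the weight is \<open>a t\<close>.\<close>
      have "distinct (take (Suc t) (?V y))"
        by (intro distinct_take distinct_map_guess es)
      then have "?V y ! t \<notin> set (take t (?V y))"
        using t by (simp add: take_Suc_conv_app_nth)
      then have "hit_avoid_prob K (?V y ! t) (set (take t (?V y))) = a t"
        using a set_take_guess(1)[OF es, of t y] t by simp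
      then show "(\<integral>x. ?E t x \<partial>measure_pmf (codebook_message K)) = a t * ?D (guess q \<pi> y (es ! t)) y"
        using t by (simp only: expectation_hit_avoid) simp
    qed
    finally show "(\<integral>x. G x y * ?D (fst x ! snd x) y \<partial>measure_pmf (codebook_message K)) =
        (\<Sum>t<length es. a t * ?D (guess q \<pi> y (es ! t)) y)" .
  qed
  also have "\<dots> = (\<Sum>t<length es. a t * guess_mass (es ! t))"
    by (simp add: guess_mass_def integrable_guess_density)
  finally show ?thesis .
qed

lemma mean_tests_eq_sum:
  assumes a: "\<And>w S. w \<notin> S \<Longrightarrow> hit_avoid_prob K (w :: bit ^ 'n) S = a (card S)"
    and es: "distinct es"
  shows "mean_tests q K \<pi> es =
    (\<Sum>t<length es. a t * (real CARD(bit ^ 'n) - (\<Sum>s<t. guess_mass (es ! s))))"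
proof -
  let ?D = "\<lambda>w y. channel_density q (w :: bit ^ 'n) y"
  let ?V = "\<lambda>y. map (guess q \<pi> y) es"
  define G :: "(bit ^ 'n) list \<times> nat \<Rightarrow> real ^ 'n \<Rightarrow> real" where
    "G x y = real (snd (query (set (fst x)) (?V y)))" for x y
  have G: "G x y = (\<Sum>t<length es. of_bool (set (fst x) \<inter> set (take t (?V y)) = {}))" for x y
    by (simp only: G_def real_query_count length_map)
  have "mean_tests q K \<pi> es = (\<integral>(x, y). G x y \<partial>ensemble q K)"
    by (simp add: mean_tests_def G_def orb_grand_def case_prod_unfold)
  also have "\<dots> = (\<integral>y. (\<integral>x. G x y * ?D (fst x ! snd x) y \<partial>measure_pmf (codebook_message K)) \<partial>lborel)"
  proof (rule integral_ensemble)
    show "G x \<in> borel_measurable borel" for x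
      unfolding G_def
      by (rule measurable_guess[of "\<lambda>g y. real (snd (query (set (fst x)) (map g es)))"]) measurable
    show "\<bar>G x y\<bar> \<le> real (length es)" for x y
    proof -
      have "\<bar>G x y\<bar> \<le> (\<Sum>t<length es. 1)"
        unfolding G by (intro order.trans[OF sum_abs] sum_mono) simp
      then show ?thesis by simp
    qed
  qed
  also have "\<dots> = (\<integral>y. (\<Sum>t<length es. a t * ((\<Sum>w\<in>UNIV. ?D w y) - (\<Sum>s<t. ?D (guess q \<pi> y (es ! s)) y))) \<partial>lborel)"
  proof (intro Bochner_Integration.integral_cong refl)
    fix y
    let ?S = "\<lambda>t. set (take t (?V y))"
    have "(\<integral>x. G x y * ?D (fst x ! snd x) y \<partial>measure_pmf (codebook_message K)) =
        (\<Sum>t<length es. \<integral>x. of_bool (set (fst x) \<inter> ?S t = {}) * ?D (fst x ! snd x) y \<partial>measure_pmf (codebook_message K))"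
      unfolding G sum_distrib_right
      by (intro Bochner_Integration.integral_sum integrable_measure_pmf_finite finite_set_pmf_codebook_message)
    also have "\<dots> = (\<Sum>t<length es. a t * ((\<Sum>w\<in>UNIV. ?D w y) - (\<Sum>s<t. ?D (guess q \<pi> y (es ! s)) y)))"
    proof (intro sum.cong refl)
      fix t assume t: "t \<in> {..<length es}"
      \<comment> \<open>Words already guessed contribute nothing; all others carry the common weight
        \<open>a t\<close>.\<close>
      have "(\<Sum>w\<in>UNIV. hit_avoid_prob K w (?S t) * ?D w y) = (\<Sum>w\<in>UNIV - ?S t. a t * ?D w y)"
        using a set_take_guess(1)[OF es, of t y] t
        by (intro sum.mono_neutral_cong_right) (auto simp: hit_avoid_prob_mem)
      also have "\<dots> = a t * ((\<Sum>w\<in>UNIV. ?D w y) - (\<Sum>w\<in>?S t. ?D w y))"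
        by (simp add: sum_diff flip: sum_distrib_left)
      also have "(\<Sum>w\<in>?S t. ?D w y) = (\<Sum>s<t. ?D (guess q \<pi> y (es ! s)) y)"
        using t by (intro set_take_guess(2) es) simp
      finally show "(\<integral>x. of_bool (set (fst x) \<inter> ?S t = {}) * ?D (fst x ! snd x) y \<partial>measure_pmf (codebook_message K))
          = a t * ((\<Sum>w\<in>UNIV. ?D w y) - (\<Sum>s<t. ?D (guess q \<pi> y (es ! s)) y))"
        by (simp only: expectation_avoid)
    qed
    finally show "(\<integral>x. G x y * ?D (fst x ! snd x) y \<partial>measure_pmf (codebook_message K)) =
        (\<Sum>t<length es. a t * ((\<Sum>w\<in>UNIV. ?D w y) - (\<Sum>s<t. ?D (guess q \<pi> y (es ! s)) y)))" .
  qed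
  \<comment> \<open>Each word's channel density integrates to 1, so the sum over all words becomes
    the number of words.\<close>
  also have "\<dots> = (\<Sum>t<length es. a t * (real CARD(bit ^ 'n) - (\<Sum>s<t. guess_mass (es ! s))))"
    by (simp add: guess_mass_def integrable_guess_density integrable_channel_density
        integral_channel_density)
  finally show ?thesis .
qed

end

section \<open>Optimality of decreasing average guessing posteriors\<close>

theorem theorem3:
  fixes q :: "bit \<Rightarrow> real \<Rightarrow> real"
    and \<pi> :: "real ^ 'n::finite \<Rightarrow> 'n \<Rightarrow> 'n"
    and A :: "(bit ^ 'n) set"
    and K T :: nat
    and e :: "nat \<Rightarrow> bit ^ 'n"
  assumes "prob_density (q 0)" and "prob_density (q 1)"
    and "permutation_law \<pi>"
    and "K \<le> CARD('n)"
    and "1 \<le> T" and "T \<le> card A"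
    and "bij_betw e {1..card A} A"
    and "\<And>i j. 1 \<le> i \<Longrightarrow> i \<le> j \<Longrightarrow> j \<le> T \<Longrightarrow> agp q K \<pi> (e i) \<ge> agp q K \<pi> (e j)"
    and "\<And>i j. 1 \<le> i \<Longrightarrow> i \<le> T \<Longrightarrow> T < j \<Longrightarrow> j \<le> card A \<Longrightarrow> agp q K \<pi> (e i) \<ge> agp q K \<pi> (e j)"
  shows "map e [1..<T + 1] \<in> orb_choices A T \<and>
    (\<forall>es \<in> orb_choices A T.
       success_prob q K \<pi> es \<le> success_prob q K \<pi> (map e [1..<T + 1]) \<and>
       mean_tests q K \<pi> (map e [1..<T + 1]) \<le> mean_tests q K \<pi> es)"
proof -
  interpret orb_setup q \<pi>
    using assms(1-3) by unfold_locales (metis bit.exhaust)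
  obtain a where a: "\<And>w S. w \<notin> S \<Longrightarrow> hit_avoid_prob K (w :: bit ^ 'n) S = a (card S)"
    and a_nonneg: "\<And>k. 0 \<le> a k"
    and a_antimono: "\<And>k. Suc k < CARD(bit ^ 'n) \<Longrightarrow> a (Suc k) \<le> a k"
    using hit_avoid_prob_profile[OF \<open>K \<le> CARD('n)\<close>] by blast
  have unif: "hit_avoid_prob K (w :: bit ^ 'n) {} = a 0" for w
    by (simp add: a)
  have "(\<Sum>w\<in>UNIV. pmf (transmitted_word K :: (bit ^ 'n) pmf) w) = 1"
    by (intro sum_pmf_eq_1) auto
  \<comment> \<open>The prior is constant and sums to 1, so it is positive; comparing posteriors
    therefore amounts to comparing \<open>guess_mass\<close>.\<close>
  then have "0 < a 0"
    using a_nonneg[of 0] by (auto simp: transmitted_word_eq_hit_avoid_prob unif less_le)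
  note agp = agp_eq_guess_mass[OF unif this]
  have success: "success_prob q K \<pi> es = (\<Sum>t<length es. a t * guess_mass (es ! t))"
    if "distinct es" for es
    using a that by (rule success_prob_eq_sum)
  have tests: "mean_tests q K \<pi> es =
      (\<Sum>t<length es. a t * (real CARD(bit ^ 'n) - (\<Sum>s<t. guess_mass (es ! s))))"
    if "distinct es" for es
    using a that by (rule mean_tests_eq_sum)
  let ?best = "map e [1..<T + 1]"
  have inj: "inj_on e {1..card A}" and img: "e ` {1..card A} = A"
    using assms(7) by (auto simp: bij_betw_def)
  \<comment> \<open>Keeps all indices below \<open>T\<close> in the range where \<open>a\<close> is
    known to decrease.\<close>
  have T_le: "T \<le> CARD(bit ^ 'n)"
    using \<open>T \<le> card A\<close> card_mono[of "UNIV :: (bit ^ 'n) set" A] by simp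
  have best: "?best \<in> orb_choices A T"
    using inj img \<open>T \<le> card A\<close>
    by (auto simp: orb_choices_def distinct_map intro: inj_on_subset)
  \<comment> \<open>A pattern outside the first \<open>k\<close> is either tested later, and the
    ordering applies, or untested, and the condition on the choice applies.\<close>
  have dom: "guess_mass (e j) \<le> guess_mass (e i)"
    if "i \<in> {1..k}" "j \<in> {1..card A}" "j \<notin> {1..k}" "k \<le> T" for i j k
  proof -
    have "agp q K \<pi> (e j) \<le> agp q K \<pi> (e i)"
      using that assms(8)[of i j] assms(9)[of i j] by (cases "j \<le> T") auto
    then show ?thesis
      using \<open>0 < a 0\<close> by (simp add: agp)
  qed
  \<comment> \<open>The first \<open>k\<close> patterns of the sorted choice dominate everything
    else in \<open>A\<close>, hence any \<open>k\<close> distinct patterns of a rival list.\<close>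
  have prefix: "(\<Sum>s<k. guess_mass (es ! s)) \<le> (\<Sum>s<k. guess_mass (?best ! s))"
    if es: "es \<in> orb_choices A T" and k: "k \<le> T" for es k
  proof -
    have sum_prefix: "(\<Sum>s<k. guess_mass (xs ! s)) = sum guess_mass (set (take k xs))"
      and card_prefix: "card (set (take k xs)) = k" if "xs \<in> orb_choices A T" for xs
      using that k
      by (auto simp: orb_choices_def sum.distinct_set_conv_list sum_list_sum_nth atLeast0LessThan distinct_card)
    have set_best: "set (take k ?best) = e ` {1..k}"
      using k by (simp add: take_map take_upt atLeastLessThanSuc_atLeastAtMost del: upt_Suc)
    have "sum guess_mass (set (take k es)) \<le> sum guess_mass (set (take k ?best))"
    proof (rule sum_le_sum_dominating)
      show "card (set (take k es)) = card (set (take k ?best))"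
        using card_prefix es best by simp
      fix x y assume "x \<in> set (take k ?best)" and y: "y \<in> set (take k es) - set (take k ?best)"
      then obtain i where i: "i \<in> {1..k}" "x = e i"
        unfolding set_best by blast
      have "y \<in> A"
        using y es by (auto simp: orb_choices_def dest: in_set_takeD)
      then obtain j where "j \<in> {1..card A}" "y = e j"
        using img by blast
      then show "guess_mass y \<le> guess_mass x"
        using dom[of i k j] i y k unfolding set_best by blast
    qed auto
    then show ?thesis
      using sum_prefix es best by simp
  qed
  have "success_prob q K \<pi> es \<le> success_prob q K \<pi> ?best \<and>
      mean_tests q K \<pi> ?best \<le> mean_tests q K \<pi> es" if es: "es \<in> orb_choices A T" for es
  proof
    have len: "length es = T" "length ?best = T" and dist: "distinct es" "distinct ?best"
      using es best by (auto simp: orb_choices_def)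
    show "success_prob q K \<pi> es \<le> success_prob q K \<pi> ?best"
      unfolding success[OF dist(1)] success[OF dist(2)] len
      using a_nonneg a_antimono prefix[OF es] T_le by (intro antimono_weighted_sum_mono) auto
    \<comment> \<open>The prefix sums enter with a minus sign and nonnegative weights, so the
      comparison holds term by term.\<close>
    show "mean_tests q K \<pi> ?best \<le> mean_tests q K \<pi> es"
      unfolding tests[OF dist(1)] tests[OF dist(2)] len
      by (intro sum_mono mult_left_mono diff_left_mono prefix[OF es] a_nonneg) simp
  qed
  with best show ?thesis
    by blast
qed

end
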